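(* Let $\mathbb{F}$ be an arbitrary field and let $\alpha \in \mathbb{F} \setminus \{0\}$. Then, for every positive integer $n$ and every $A \in \mathrm{M}_n(\mathbb{F})$, there exist scalars $\beta,\gamma \in \mathbb{F}$ such that the block-diagonal matrix $A \oplus \alpha I_n \in \mathrm{M}_{2n}(\mathbb{F})$ is an $(\alpha,\beta,\gamma)$-composite.
   Context: $\mathrm{M}_n(\mathbb{F})$ denotes the algebra of all $n \times n$ matrices with entries in $\mathbb{F}$. Given scalars $\alpha_1,\dots,\alpha_k$ in $\mathbb{F}$, a matrix $M \in \mathrm{M}_m(\mathbb{F})$ is called an $(\alpha_1,\dots,\alpha_k)$-composite when there are idempotent matrices $P_1,\dots,P_k$ of $\mathrm{M}_m(\mathbb{F})$ (i.e. $P_i^2=P_i$) such that $M=\sum_{i=1}^k \alpha_i P_i$. $X \oplus Y$ denotes the block-diagonal matrix with diagonal blocks $X$ and $Y$. *)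

theory Defs
  imports Jordan_Normal_Form.Matrix
begin

text \<open>The sum is folded from \<open>0\<^sub>m m m\<close> because \<open>'a mat\<close> has no type-wide zero:
  \<open>sum\<close> and \<open>sum_list\<close> are not available on it.\<close>

definition composite :: "nat \<Rightarrow> 'a::field list \<Rightarrow> 'a mat \<Rightarrow> bool" where
  "composite m as M \<longleftrightarrow>
     (\<exists>Ps. length Ps = length as \<and>
           (\<forall>P \<in> set Ps. P \<in> carrier_mat m m \<and> P * P = P) \<and>
           M = foldr (+) (map2 (\<lambda>a P. a \<cdot>\<^sub>m P) as Ps) (0\<^sub>m m m))"

end

theory Submission
  imports Defs "Jordan_Normal_Form.Jordan_Normal_Form_Existence"
begin

text \<open>
  Write \<open>A = B + \<alpha> I\<close>. The goal is to find an idempotent \<open>P\<close> such that \<open>N = (A \<oplus> \<alpha> I) - \<alpha> P\<close> has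
  zero as its only eigenvalue, with the possible exception of one simple eigenvalue \<open>b\<close>. Such an
  \<open>N\<close> is a scaled difference \<open>\<beta> (Q - R)\<close> of two idempotents, so that \<open>\<beta>\<close> and \<open>\<gamma> = - \<beta>\<close> do the
  job: nilpotent Jordan blocks are scaled differences for every nonzero \<open>\<beta>\<close>, and taking \<open>\<beta> = b\<close>
  takes care of the remaining block \<open>b = b (1 - 0)\<close>
  (\<open>upper_triangular_one_eigenvalue_difference\<close>). The trace of \<open>N\<close> is thus absorbed by \<open>\<beta>\<close>, which
  is why no restriction on the field or its characteristic arises.

  Equivalently \<open>N = (B \<oplus> 0) + \<alpha> P'\<close> for the idempotent \<open>P' = I - P\<close>, and the zero block provides the
  room for \<open>P'\<close>. Suppose first that \<open>B\<close> is invertible. For every splitting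
  \<open>X + Y = B + \<alpha> I = A\<close>, the matrix \<open>B \<oplus> 0\<close> has a conjugate whose two block rows both equal \<open>[Y - \<alpha> I, X]\<close>. Every matrix \<open>P' = [[I, 0], [Z, 0]]\<close> is idempotent, and
  the choice \<open>Z = I - Y / \<alpha>\<close> leads to \<open>N = [[Y, X], [0, X]]\<close>
  (\<open>composite_from_splitting\<close>). A nonscalar matrix is similar to one whose diagonal is zero except in
  the last place (\<open>scalar_or_similar_zero_diagonal\<close>), and for such an \<open>A\<close> one takes \<open>Y\<close> to be the
  strictly lower part and \<open>X\<close> the upper part.

  If \<open>B\<close> is singular, of rank \<open>r\<close>, the same construction is carried out on the image of \<open>B\<close>. In a
  suitable basis the last rows of \<open>B\<close> vanish and \<open>B G = F\<close> for some \<open>G\<close>, where \<open>F\<close> is the identity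
  truncated to the first \<open>r\<close> coordinates (\<open>similar_to_independent_rows\<close>). Then \<open>B + \<alpha> F\<close> replaces
  \<open>A\<close>, and only its leading \<open>r\<close> by \<open>r\<close> block needs to be nonscalar. When that block is scalar, \<open>B\<close>
  satisfies \<open>B\<^sup>2 = s B\<close> for a scalar \<open>s\<close>, and a decomposition can be written down directly
  (\<open>composite_shift_block_quadratic\<close>).
\<close>

section \<open>Composites of three idempotents and similarity\<close>

lemma composite_three_iff:
  "composite m [a, b, c] M \<longleftrightarrow>
     (\<exists>P Q R. P \<in> carrier_mat m m \<and> Q \<in> carrier_mat m m \<and> R \<in> carrier_mat m m \<and>
        P * P = P \<and> Q * Q = Q \<and> R * R = R \<and> M = a \<cdot>\<^sub>m P + (b \<cdot>\<^sub>m Q + c \<cdot>\<^sub>m R))"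
    (is "_ \<longleftrightarrow> ?rhs")
proof
  assume "composite m [a, b, c] M"
  then obtain Ps where len: "length Ps = Suc (Suc (Suc 0))"
    and idem: "\<forall>P \<in> set Ps. P \<in> carrier_mat m m \<and> P * P = P"
    and M: "M = foldr (+) (map2 (\<lambda>a P. a \<cdot>\<^sub>m P) [a, b, c] Ps) (0\<^sub>m m m)"
    unfolding composite_def by (auto simp del: foldr_Cons)
  from len obtain P Q R where Ps: "Ps = [P, Q, R]"
    by (auto simp: length_Suc_conv)
  with idem M show ?rhs
    by (intro exI[of _ P] exI[of _ Q] exI[of _ R]) auto
next
  assume ?rhs
  then obtain P Q R where "P \<in> carrier_mat m m" "Q \<in> carrier_mat m m" "R \<in> carrier_mat m m"
    "P * P = P" "Q * Q = Q" "R * R = R" "M = a \<cdot>\<^sub>m P + (b \<cdot>\<^sub>m Q + c \<cdot>\<^sub>m R)"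
    by blast
  then show "composite m [a, b, c] M"
    unfolding composite_def by (intro exI[of _ "[P, Q, R]"]) auto
qed

lemma idempotent_conjugate:
  fixes P :: "'a::semiring_1 mat"
  assumes c: "P \<in> carrier_mat m m" "U \<in> carrier_mat m m" "V \<in> carrier_mat m m"
    and VU: "V * U = 1\<^sub>m m" and PP: "P * P = P"
  shows "(U * P * V) * (U * P * V) = U * P * V"
proof -
  have "(U * P * V) * (U * P * V) = U * (P * ((V * U) * (P * V)))"
    using c by (simp add: assoc_mult_mat[of _ m m _ m _ m])
  also have "\<dots> = U * ((P * P) * V)"
    using c by (simp add: VU assoc_mult_mat[of _ m m _ m _ m])
  also have "\<dots> = U * P * V"
    using c by (simp add: PP assoc_mult_mat[of _ m m _ m _ m])
  finally show ?thesis .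
qed

lemma composite_similar:
  assumes sim: "similar_mat M M'" and comp: "composite m [a, b, c] M'"
  shows "composite m [a, b, c] M"
proof -
  from comp obtain P Q R where c: "P \<in> carrier_mat m m" "Q \<in> carrier_mat m m" "R \<in> carrier_mat m m"
    and id: "P * P = P" "Q * Q = Q" "R * R = R"
    and M': "M' = a \<cdot>\<^sub>m P + (b \<cdot>\<^sub>m Q + c \<cdot>\<^sub>m R)"
    unfolding composite_three_iff by blast
  from c M' have "M' \<in> carrier_mat m m" by auto
  with similar_matD[OF sim] obtain U V where UV: "U \<in> carrier_mat m m" "V \<in> carrier_mat m m"
    and VU: "V * U = 1\<^sub>m m" and M: "M = U * M' * V"
    by (metis carrier_matD(1) insert_subset)
  have "M = a \<cdot>\<^sub>m (U * P * V) + (b \<cdot>\<^sub>m (U * Q * V) + c \<cdot>\<^sub>m (U * R * V))"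
    unfolding M M' using c UV
    by (simp add: mult_add_distrib_mat[of _ m m _ m] add_mult_distrib_mat[of _ m m _ _ m]
        mult_smult_distrib[of _ m m _ m] mult_smult_assoc_mat[of _ m m _ m])
  then show ?thesis
    unfolding composite_three_iff
    using c UV idempotent_conjugate[OF c(1) UV VU id(1)] idempotent_conjugate[OF c(2) UV VU id(2)]
      idempotent_conjugate[OF c(3) UV VU id(3)]
    by (intro exI[of _ "U * P * V"] exI[of _ "U * Q * V"] exI[of _ "U * R * V"]) auto
qed

section \<open>Scaled differences of two idempotents\<close>

definition scaled_idempotent_difference :: "nat \<Rightarrow> 'a::field \<Rightarrow> 'a mat \<Rightarrow> bool" where
  "scaled_idempotent_difference m b M \<longleftrightarrow>
     (\<exists>Q R. Q \<in> carrier_mat m m \<and> R \<in> carrier_mat m m \<and> Q * Q = Q \<and> R * R = R \<and>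
        M = b \<cdot>\<^sub>m Q + (- b) \<cdot>\<^sub>m R)"

lemma scaled_idempotent_difference_similar:
  assumes sim: "similar_mat M M'" and diff: "scaled_idempotent_difference m b M'"
  shows "scaled_idempotent_difference m b M"
proof -
  from diff obtain Q R where c: "Q \<in> carrier_mat m m" "R \<in> carrier_mat m m"
    and id: "Q * Q = Q" "R * R = R"
    and M': "M' = b \<cdot>\<^sub>m Q + (- b) \<cdot>\<^sub>m R"
    unfolding scaled_idempotent_difference_def by blast
  from c M' have "M' \<in> carrier_mat m m" by auto
  with similar_matD[OF sim] obtain U V where UV: "U \<in> carrier_mat m m" "V \<in> carrier_mat m m"
    and VU: "V * U = 1\<^sub>m m" and M: "M = U * M' * V"
    by (metis carrier_matD(1) insert_subset)
  have "M = b \<cdot>\<^sub>m (U * Q * V) + (- b) \<cdot>\<^sub>m (U * R * V)"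
    unfolding M M' using c UV
    by (simp add: mult_add_distrib_mat[of _ m m _ m] add_mult_distrib_mat[of _ m m _ _ m]
        mult_smult_distrib[of _ m m _ m] mult_smult_assoc_mat[of _ m m _ m])
  then show ?thesis
    unfolding scaled_idempotent_difference_def
    using c UV idempotent_conjugate[OF c(1) UV VU id(1)] idempotent_conjugate[OF c(2) UV VU id(2)]
    by (intro exI[of _ "U * Q * V"] exI[of _ "U * R * V"]) auto
qed

lemma scaled_idempotent_difference_four_block:
  assumes M: "scaled_idempotent_difference m b M" and L: "scaled_idempotent_difference l b L"
  shows "scaled_idempotent_difference (m + l) b (four_block_mat M (0\<^sub>m m l) (0\<^sub>m l m) L)"
proof -
  from M obtain Q R where c: "Q \<in> carrier_mat m m" "R \<in> carrier_mat m m"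
    and id: "Q * Q = Q" "R * R = R" and M: "M = b \<cdot>\<^sub>m Q + (- b) \<cdot>\<^sub>m R"
    unfolding scaled_idempotent_difference_def by blast
  from L obtain Q' R' where c': "Q' \<in> carrier_mat l l" "R' \<in> carrier_mat l l"
    and id': "Q' * Q' = Q'" "R' * R' = R'" and L: "L = b \<cdot>\<^sub>m Q' + (- b) \<cdot>\<^sub>m R'"
    unfolding scaled_idempotent_difference_def by blast
  let ?D = "\<lambda>X Y. four_block_mat X (0\<^sub>m m l) (0\<^sub>m l m) Y"
  have idem: "?D X Y * ?D X Y = ?D X Y"
    if "X \<in> carrier_mat m m" "Y \<in> carrier_mat l l" "X * X = X" "Y * Y = Y" for X Y :: "'a mat"
    using that by (subst mult_four_block_mat[of _ m m _ l _ l]) auto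
  have "?D M L = b \<cdot>\<^sub>m ?D Q Q' + (- b) \<cdot>\<^sub>m ?D R R'"
    unfolding M L using c c' by (intro eq_matI) auto
  then show ?thesis
    unfolding scaled_idempotent_difference_def
    using c c' idem[OF c(1) c'(1) id(1) id'(1)] idem[OF c(2) c'(2) id(2) id'(2)]
    by (intro exI[of _ "?D Q Q'"] exI[of _ "?D R R'"]) auto
qed

text \<open>Grade the basis by the parity of the index and let \<open>D\<close> be the projection onto the odd basis
  vectors. The nilpotent Jordan block is odd for this grading: it is the sum of a part \<open>J\<^sub>1\<close> with
  \<open>D * J\<^sub>1 = J\<^sub>1\<close> and \<open>J\<^sub>1 * D = 0\<close> (the odd rows), and a part \<open>J\<^sub>0\<close> with \<open>D * J\<^sub>0 = 0\<close> and
  \<open>J\<^sub>0 * D = J\<^sub>0\<close> (the even rows). Both parts square to zero, so \<open>D + J\<^sub>1 / b\<close> and \<open>D - J\<^sub>0 / b\<close>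
  are idempotent.\<close>

lemma nilpotent_jordan_block_difference:
  assumes b: "b \<noteq> 0"
  shows "scaled_idempotent_difference k b (jordan_block k 0)"
proof -
  let ?Q = "mat k k (\<lambda>(i, j). if i = j then (if odd i then 1 else 0)
              else if Suc i = j \<and> odd i then 1 / b else 0)"
  let ?R = "mat k k (\<lambda>(i, j). if i = j then (if odd i then 1 else 0)
              else if Suc i = j \<and> even i then - 1 / b else 0)"
  have Q: "?Q * ?Q = ?Q"
  proof (rule eq_matI)
    fix i j assume ij: "i < dim_row ?Q" "j < dim_col ?Q"
    then have ij: "i < k" "j < k" by auto
    have "(?Q * ?Q) $$ (i, j) = (\<Sum>l = 0..<k. ?Q $$ (i, l) * ?Q $$ (l, j))"
      using ij by (simp add: scalar_prod_def)
    also have "\<dots> = (\<Sum>l \<in> {0..<k} \<inter> {i, Suc i}. ?Q $$ (i, l) * ?Q $$ (l, j))"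
      using ij by (intro sum.mono_neutral_right) auto
    also have "\<dots> = ?Q $$ (i, j)"
      using ij by (cases "Suc i < k") (auto simp: Int_insert_right)
    finally show "(?Q * ?Q) $$ (i, j) = ?Q $$ (i, j)" .
  qed auto
  have R: "?R * ?R = ?R"
  proof (rule eq_matI)
    fix i j assume ij: "i < dim_row ?R" "j < dim_col ?R"
    then have ij: "i < k" "j < k" by auto
    have "(?R * ?R) $$ (i, j) = (\<Sum>l = 0..<k. ?R $$ (i, l) * ?R $$ (l, j))"
      using ij by (simp add: scalar_prod_def)
    also have "\<dots> = (\<Sum>l \<in> {0..<k} \<inter> {i, Suc i}. ?R $$ (i, l) * ?R $$ (l, j))"
      using ij by (intro sum.mono_neutral_right) auto
    also have "\<dots> = ?R $$ (i, j)"
      using ij by (cases "Suc i < k") (auto simp: Int_insert_right)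
    finally show "(?R * ?R) $$ (i, j) = ?R $$ (i, j)" .
  qed auto
  have "jordan_block k 0 = b \<cdot>\<^sub>m ?Q + (- b) \<cdot>\<^sub>m ?R"
    using b by (intro eq_matI) auto
  with Q R show ?thesis
    unfolding scaled_idempotent_difference_def
    by (intro exI[of _ ?Q] exI[of _ ?R]) auto
qed

lemma jordan_matrix_difference:
  assumes b: "b \<noteq> 0" and blocks: "\<And>k a. (k, a) \<in> set n_as \<Longrightarrow> a = 0 \<or> k = 1 \<and> a = b"
  shows "scaled_idempotent_difference (sum_list (map fst n_as)) b (jordan_matrix n_as)"
  using blocks
proof (induction n_as)
  case Nil
  have "jordan_matrix [] = b \<cdot>\<^sub>m 0\<^sub>m 0 0 + (- b) \<cdot>\<^sub>m 0\<^sub>m 0 0"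
    by (intro eq_matI) auto
  then show ?case
    unfolding scaled_idempotent_difference_def
    by (intro exI[of _ "0\<^sub>m 0 0"]) auto
next
  case (Cons ka n_as)
  obtain k a where ka: "ka = (k, a)" by force
  have "scaled_idempotent_difference k b (jordan_block k a)"
  proof (cases "a = 0")
    case True
    with nilpotent_jordan_block_difference[OF b] show ?thesis by simp
  next
    case False
    with Cons.prems[of k a] ka have k: "k = 1" and a: "a = b" by auto
    have "jordan_block 1 b = b \<cdot>\<^sub>m 1\<^sub>m 1 + (- b) \<cdot>\<^sub>m 0\<^sub>m 1 1"
      by (intro eq_matI) auto
    then show ?thesis
      unfolding scaled_idempotent_difference_def k a
      by (intro exI[of _ "1\<^sub>m 1"] exI[of _ "0\<^sub>m 1 1"]) auto
  qed
  from scaled_idempotent_difference_four_block[OF this Cons.IH] Cons.prems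
  show ?case by (simp add: ka jordan_matrix_Cons)
qed

text \<open>Zero is a possible eigenvalue of any size of block in a scaled difference, whereas the nonzero
  eigenvalue, if there is one, is a simple root of the characteristic polynomial. It therefore
  occupies a single block of size one, and it is this eigenvalue that dictates the scalar \<open>b\<close>.\<close>

lemma upper_triangular_one_eigenvalue_difference:
  fixes N :: "'a::field mat"
  assumes N: "N \<in> carrier_mat m m" and ut: "upper_triangular N" and p: "p < m"
    and diag: "\<And>i. i < m \<Longrightarrow> i \<noteq> p \<Longrightarrow> N $$ (i, i) = 0"
  shows "\<exists>b. scaled_idempotent_difference m b N"
proof -
  define d where "d = N $$ (p, p)"
  define n_as where "n_as = triangular_to_jnf_vector N"
  have jnf: "jordan_nf N n_as"
    unfolding n_as_def by (rule triangular_to_jnf_vector[OF N ut])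
  then have sim: "similar_mat N (jordan_matrix n_as)" and pos: "0 \<notin> fst ` set n_as"
    unfolding jordan_nf_def by auto
  from similar_matD[OF sim] N have len: "sum_list (map fst n_as) = m"
    by (metis carrier_matD(1) insert_subset jordan_matrix_dim(1))
  have "char_poly N = (\<Prod>i = 0..<m. [:- N $$ (i, i), 1:])"
    using N by (simp add: char_poly_upper_triangular[OF N ut] diag_mat_def o_def prod.list_conv_set_nth)
  also have "\<dots> = [:- d, 1:] * (\<Prod>i \<in> {0..<m} - {p}. [:- N $$ (i, i), 1:])"
    using p by (subst prod.remove[of _ p]) (auto simp: d_def)
  also have "(\<Prod>i \<in> {0..<m} - {p}. [:- N $$ (i, i), 1:]) = (\<Prod>i \<in> {0..<m} - {p}. [:- 0, 1:])"
    using diag by (intro prod.cong) auto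
  also have "\<dots> = [:- 0, 1:] ^ (m - 1)"
    using p by simp
  finally have cp: "char_poly N = [:- d, 1:] * [:- 0, 1:] ^ (m - 1)" .
  have blocks: "a = 0 \<or> k = 1 \<and> a = d" if ka: "(k, a) \<in> set n_as" for k a
  proof (cases "a = 0")
    case False
    have "k \<noteq> 0" using pos ka by force
    have "k \<le> Polynomial.order a (char_poly N)"
      by (rule jordan_nf_block_size_order_bound[OF jnf ka])
    also have "\<dots> = Polynomial.order a [:- d, 1:] + Polynomial.order a ([:- 0, 1:] ^ (m - 1))"
      unfolding cp by (intro order_mult no_zero_divisors power_not_zero) auto
    also have "Polynomial.order a ([:- 0, 1:] ^ (m - 1)) = 0"
      using False by (intro order_0I) simp
    also have "Polynomial.order a [:- d, 1:] = (if a = d then 1 else 0)"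
      using order_power_n_n[of d 1] by (auto intro: order_0I)
    finally show ?thesis using \<open>k \<noteq> 0\<close> by (auto split: if_splits)
  qed simp
  \<comment> \<open>For a nilpotent matrix every nonzero scale works.\<close>
  define b where "b = (if d = 0 then 1 else d)"
  have "scaled_idempotent_difference m b (jordan_matrix n_as)"
    unfolding len[symmetric]
    by (rule jordan_matrix_difference) (use blocks in \<open>auto simp: b_def\<close>)
  with scaled_idempotent_difference_similar[OF sim] show ?thesis by blast
qed

section \<open>Prescribing a zero diagonal up to similarity\<close>

lemma nonscalar_similar_nonzero_below_corner:
  fixes S :: "'a::field mat"
  assumes S: "S \<in> carrier_mat r r" and nonscalar: "\<not> (\<exists>c. S = c \<cdot>\<^sub>m 1\<^sub>m r)"
  shows "\<exists>Z. Z \<in> carrier_mat r r \<and> similar_mat S Z \<and> 2 \<le> r \<and> Z $$ (1, 0) \<noteq> 0"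
proof -
  obtain Z i j where Z: "Z \<in> carrier_mat r r" "similar_mat S Z"
    and ij: "i < r" "j < r" "i \<noteq> j" "Z $$ (i, j) \<noteq> 0"
  proof (cases "\<exists>i j. i < r \<and> j < r \<and> i \<noteq> j \<and> S $$ (i, j) \<noteq> 0")
    case True
    then obtain i j where "i < r" "j < r" "i \<noteq> j" "S $$ (i, j) \<noteq> 0" by blast
    then show ?thesis by (rule that[OF S similar_mat_refl[OF S]])
  next
    case False
    have "\<exists>i j. i < r \<and> j < r \<and> S $$ (i, i) \<noteq> S $$ (j, j)"
    proof (rule ccontr)
      assume eq: "\<not> ?thesis"
      define d where "d = S $$ (0, 0)"
      have "S $$ (i, i) = d" if i: "i < r" for i
      proof -
        from i have "0 < r" by simp
        with eq i show ?thesis unfolding d_def by blast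
      qed
      with False S have "S = d \<cdot>\<^sub>m 1\<^sub>m r"
        by (intro eq_matI) auto
      with nonscalar show False by blast
    qed
    then obtain i j where ij: "i < r" "j < r" "S $$ (i, i) \<noteq> S $$ (j, j)" by blast
    then have "i \<noteq> j" by auto
    from False ij \<open>i \<noteq> j\<close> have off: "S $$ (i, j) = 0" "S $$ (j, i) = 0" by auto
    have "add_col_sub_row 1 i j S $$ (i, j) \<noteq> 0"
      using off S ij \<open>i \<noteq> j\<close> by simp
    moreover have "add_col_sub_row 1 i j S \<in> carrier_mat r r" using S by simp
    ultimately show ?thesis
      using that ij(1,2) \<open>i \<noteq> j\<close>
        similar_mat_sym[OF add_col_sub_row_similar[OF S ij(1,2) \<open>i \<noteq> j\<close>, of 1]]
      by blast
  qed
  define Z1 where "Z1 = swap_cols_rows 0 j Z"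
  define i' where "i' = (if i = 0 then j else i)"
  have r: "2 \<le> r" using ij by auto
  have i': "0 < i'" "i' < r" using ij by (auto simp: i'_def)
  have Z1: "Z1 \<in> carrier_mat r r" using Z by (simp add: Z1_def)
  have Z1i: "Z1 $$ (i', 0) \<noteq> 0" using Z ij r by (auto simp: Z1_def i'_def)
  define Z2 where "Z2 = swap_cols_rows 1 i' Z1"
  have Z2: "Z2 \<in> carrier_mat r r" using Z1 by (simp add: Z2_def)
  have Z210: "Z2 $$ (1, 0) \<noteq> 0" using Z1 Z1i i' r by (auto simp: Z2_def)
  have sim1: "similar_mat Z1 Z"
    unfolding Z1_def by (rule swap_cols_rows_similar[OF Z(1)]) (use r ij in auto)
  have sim2: "similar_mat Z2 Z1"
    unfolding Z2_def by (rule swap_cols_rows_similar[OF Z1]) (use r i' in auto)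
  have "similar_mat S Z2"
    using similar_mat_trans[OF Z(2) similar_mat_sym[OF similar_mat_trans[OF sim2 sim1]]] .
  with Z2 Z210 r show ?thesis by blast
qed

definition lower_right :: "'a mat \<Rightarrow> 'a mat" where
  "lower_right Z = mat (dim_row Z - 1) (dim_col Z - 1) (\<lambda>(i, j). Z $$ (Suc i, Suc j))"

text \<open>Subtracting a multiple of row 1 from row 0 kills the corner entry; the compensating column
  operation changes column 1 only, so the other entries below row 0 survive.\<close>

lemma clear_corner:
  fixes Z :: "'a::field mat"
  assumes Z: "Z \<in> carrier_mat r r" and r: "2 \<le> r" and Z10: "Z $$ (1, 0) \<noteq> 0"
  obtains Z' where "Z' \<in> carrier_mat r r" "similar_mat Z Z'" "Z' $$ (0, 0) = 0"
    "Z' $$ (1, 0) \<noteq> 0"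
    "\<And>i j. 0 < i \<Longrightarrow> i < r \<Longrightarrow> j < r \<Longrightarrow> j \<noteq> 1 \<Longrightarrow> Z' $$ (i, j) = Z $$ (i, j)"
proof
  let ?Z = "add_col_sub_row (Z $$ (0, 0) / Z $$ (1, 0)) 0 1 Z"
  show "?Z \<in> carrier_mat r r" using Z by simp
  show "similar_mat Z ?Z"
    by (rule similar_mat_sym[OF add_col_sub_row_similar[OF Z]]) (use r in auto)
  show "?Z $$ (0, 0) = 0" "?Z $$ (1, 0) \<noteq> 0" using Z r Z10 by auto
  show "?Z $$ (i, j) = Z $$ (i, j)" if "0 < i" "i < r" "j < r" "j \<noteq> 1" for i j
    using Z r that by auto
qed

text \<open>The lower right block must stay nonscalar for the induction to continue. When clearing the corner
  leaves a scalar block, adding column 0 to column 2 puts a nonzero entry at position \<open>(1, 2)\<close>.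
  This spoils the corner, but clearing it a second time changes column 2 in row 0 only. For \<open>r = 2\<close>
  the lower right block has size one and no further step is needed.\<close>

lemma nonscalar_deflation:
  fixes S :: "'a::field mat"
  assumes S: "S \<in> carrier_mat r r" and nonscalar: "\<not> (\<exists>c. S = c \<cdot>\<^sub>m 1\<^sub>m r)"
  obtains Z where "Z \<in> carrier_mat r r" "similar_mat S Z" "2 \<le> r" "Z $$ (0, 0) = 0"
    "r = 2 \<or> \<not> (\<exists>c. lower_right Z = c \<cdot>\<^sub>m 1\<^sub>m (r - 1))"
proof -
  obtain Z0 where Z0: "Z0 \<in> carrier_mat r r" "similar_mat S Z0" "Z0 $$ (1, 0) \<noteq> 0" and r: "2 \<le> r"
    using nonscalar_similar_nonzero_below_corner[OF S nonscalar] by blast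
  obtain Z1 where Z1: "Z1 \<in> carrier_mat r r" "similar_mat Z0 Z1" "Z1 $$ (0, 0) = 0"
    "Z1 $$ (1, 0) \<noteq> 0"
    using clear_corner[OF Z0(1) r Z0(3)] by metis
  have sim1: "similar_mat S Z1" using Z0 Z1 similar_mat_trans by blast
  show thesis
  proof (cases "r = 2 \<or> \<not> (\<exists>c. lower_right Z1 = c \<cdot>\<^sub>m 1\<^sub>m (r - 1))")
    case True
    with that[of Z1] Z1 sim1 r show ?thesis by blast
  next
    case False
    then obtain c where c: "lower_right Z1 = c \<cdot>\<^sub>m 1\<^sub>m (r - 1)" and r3: "2 < r"
      using r by auto
    have "lower_right Z1 $$ (0, 1) = 0" unfolding c using r3 by simp
    then have Z112: "Z1 $$ (1, 2) = 0"
      using Z1(1) r3 by (simp add: lower_right_def numeral_2_eq_2)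
    define Z2 where "Z2 = add_col_sub_row 1 0 2 Z1"
    have Z2: "Z2 \<in> carrier_mat r r" using Z1 by (simp add: Z2_def)
    have sim2: "similar_mat Z1 Z2"
      unfolding Z2_def by (rule similar_mat_sym[OF add_col_sub_row_similar[OF Z1(1)]]) (use r3 in auto)
    have Z210: "Z2 $$ (1, 0) \<noteq> 0" and Z212: "Z2 $$ (1, 2) \<noteq> 0"
      using Z1 Z112 r3 by (auto simp: Z2_def)
    obtain Z3 where Z3: "Z3 \<in> carrier_mat r r" "similar_mat Z2 Z3" "Z3 $$ (0, 0) = 0"
      and keep: "\<And>i j. 0 < i \<Longrightarrow> i < r \<Longrightarrow> j < r \<Longrightarrow> j \<noteq> 1 \<Longrightarrow> Z3 $$ (i, j) = Z2 $$ (i, j)"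
      using clear_corner[OF Z2 r Z210] by metis
    have "Z3 $$ (1, 2) \<noteq> 0" using keep[of 1 2] Z212 r3 by simp
    then have off: "lower_right Z3 $$ (0, 1) \<noteq> 0"
      using Z3(1) r3 by (simp add: lower_right_def numeral_2_eq_2)
    have "\<not> (\<exists>c. lower_right Z3 = c \<cdot>\<^sub>m 1\<^sub>m (r - 1))"
    proof
      assume "\<exists>c. lower_right Z3 = c \<cdot>\<^sub>m 1\<^sub>m (r - 1)"
      then obtain c' where "lower_right Z3 = c' \<cdot>\<^sub>m 1\<^sub>m (r - 1)" by blast
      then have "lower_right Z3 $$ (0, 1) = 0" using r3 by simp
      with off show False by blast
    qed
    then show ?thesis
      using that[of Z3] Z3 r sim1 sim2 similar_mat_trans by blast
  qed
qed

text \<open>A classical fact over every field: the diagonal of a nonscalar matrix can be prescribed up to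
  similarity, subject only to the trace. Here the prescribed entries are zero, and the trace ends
  up in the last one.\<close>

lemma scalar_or_similar_zero_diagonal:
  fixes S :: "'a::field mat"
  assumes "S \<in> carrier_mat r r"
  shows "(\<exists>c. S = c \<cdot>\<^sub>m 1\<^sub>m r) \<or>
    (\<exists>S'. similar_mat S S' \<and> (\<forall>i. Suc i < r \<longrightarrow> S' $$ (i, i) = 0))"
  using assms
proof (induction r arbitrary: S)
  case 0
  then have "S = 0 \<cdot>\<^sub>m 1\<^sub>m 0" by (intro eq_matI) auto
  then show ?case by blast
next
  case (Suc q)
  show ?case
  proof (cases "\<exists>c. S = c \<cdot>\<^sub>m 1\<^sub>m (Suc q)")
    case False
    from nonscalar_deflation[OF Suc.prems this] obtain Z where
      Z: "Z \<in> carrier_mat (Suc q) (Suc q)" "similar_mat S Z" and q: "2 \<le> Suc q" and Z00: "Z $$ (0, 0) = 0"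
      and low: "Suc q = 2 \<or> \<not> (\<exists>c. lower_right Z = c \<cdot>\<^sub>m 1\<^sub>m (Suc q - 1))" by metis
    show ?thesis
    proof (cases "Suc q = 2")
      case True
      with Z Z00 show ?thesis by (auto intro!: exI[of _ Z])
    next
      case False
      let ?T = "lower_right Z"
      have T: "?T \<in> carrier_mat q q" using Z by (simp add: lower_right_def)
      from Suc.IH[OF T] low False obtain T' where T': "similar_mat ?T T'"
        and diag: "\<forall>i. Suc i < q \<longrightarrow> T' $$ (i, i) = 0" by auto
      from T' obtain P Q where wit: "similar_mat_wit ?T T' P Q" unfolding similar_mat_def by blast
      note PQ = similar_mat_witD2[OF T wit]
      define a u v where "a = mat 1 1 (\<lambda>_. 0::'a)"
        and "u = mat 1 q (\<lambda>(i, j). Z $$ (0, Suc j))"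
        and "v = mat q 1 (\<lambda>(i, j). Z $$ (Suc i, 0))"
      have carr: "a \<in> carrier_mat 1 1" "u \<in> carrier_mat 1 q" "v \<in> carrier_mat q 1"
        by (auto simp: a_def u_def v_def)
      have Zblock: "Z = four_block_mat a u v ?T"
        using Z Z00 by (intro eq_matI) (auto simp: a_def u_def v_def lower_right_def)
      have "similar_mat_wit (four_block_mat a u v ?T) (four_block_mat a (u * P) (Q * v) T')
        (four_block_mat (1\<^sub>m 1) (0\<^sub>m 1 q) (0\<^sub>m q 1) P) (four_block_mat (1\<^sub>m 1) (0\<^sub>m 1 q) (0\<^sub>m q 1) Q)"
      proof (rule similar_mat_wit_four_block[OF similar_mat_wit_refl wit])
        show "u = 1\<^sub>m 1 * (u * P) * Q"
          using carr PQ by (simp add: assoc_mult_mat[of _ 1 q _ q _ q])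
        show "v = P * (Q * v) * 1\<^sub>m 1"
          using carr PQ by (simp flip: assoc_mult_mat[of _ q q _ q _ 1])
      qed (use carr PQ T in auto)
      then have "similar_mat Z (four_block_mat a (u * P) (Q * v) T')"
        unfolding Zblock[symmetric] similar_mat_def by blast
      with Z(2) have "similar_mat S (four_block_mat a (u * P) (Q * v) T')"
        by (rule similar_mat_trans)
      moreover have "four_block_mat a (u * P) (Q * v) T' $$ (i, i) = 0" if "Suc i < Suc q" for i
        using that diag carr PQ by (cases i) (auto simp: a_def)
      ultimately show ?thesis by blast
    qed
  qed blast
qed

section \<open>Separating the image of a matrix\<close>

definition truncated_one :: "nat \<Rightarrow> nat \<Rightarrow> 'a::{zero,one} mat" where
  "truncated_one n r = mat n n (\<lambda>(i, j). if i = j \<and> i < r then 1 else 0)"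

lemma truncated_one_carrier [simp]:
  "truncated_one n r \<in> carrier_mat n n"
  "dim_row (truncated_one n r) = n" "dim_col (truncated_one n r) = n"
  by (simp_all add: truncated_one_def)

lemma truncated_one_mult_left:
  fixes Y :: "'a::semiring_1 mat"
  assumes Y: "Y \<in> carrier_mat n n"
  shows "truncated_one n r * Y = mat n n (\<lambda>(i, j). if i < r then Y $$ (i, j) else 0)"
proof (rule eq_matI)
  fix i j assume "i < dim_row (mat n n (\<lambda>(i, j). if i < r then Y $$ (i, j) else 0))"
    "j < dim_col (mat n n (\<lambda>(i, j). if i < r then Y $$ (i, j) else 0))"
  then have ij: "i < n" "j < n" by auto
  have "(truncated_one n r * Y) $$ (i, j) = (\<Sum>l = 0..<n. (if l = i then (if i < r then Y $$ (i, j) else 0) else 0))"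
    using ij Y by (auto simp: truncated_one_def scalar_prod_def simp del: sum.delta sum.delta' intro!: sum.cong)
  then show "(truncated_one n r * Y) $$ (i, j) = mat n n (\<lambda>(i, j). if i < r then Y $$ (i, j) else 0) $$ (i, j)"
    using ij by simp
qed (use Y in auto)

lemma truncated_one_mult_right:
  fixes Y :: "'a::semiring_1 mat"
  assumes Y: "Y \<in> carrier_mat n n"
  shows "Y * truncated_one n r = mat n n (\<lambda>(i, j). if j < r then Y $$ (i, j) else 0)"
proof (rule eq_matI)
  fix i j assume "i < dim_row (mat n n (\<lambda>(i, j). if j < r then Y $$ (i, j) else 0))"
    "j < dim_col (mat n n (\<lambda>(i, j). if j < r then Y $$ (i, j) else 0))"
  then have ij: "i < n" "j < n" by auto
  have "(Y * truncated_one n r) $$ (i, j) = (\<Sum>l = 0..<n. (if l = j then (if j < r then Y $$ (i, j) else 0) else 0))"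
    using ij Y by (auto simp: truncated_one_def scalar_prod_def simp del: sum.delta sum.delta' intro!: sum.cong sum.neutral)
  then show "(Y * truncated_one n r) $$ (i, j) = mat n n (\<lambda>(i, j). if j < r then Y $$ (i, j) else 0) $$ (i, j)"
    using ij by simp
qed (use Y in auto)

text \<open>The first \<open>r\<close> rows of \<open>B'\<close> form a surjective map and \<open>G\<close> contains a right inverse of it. They come
  from the reduced row echelon form \<open>P * B\<close>: multiplying it from the right by the inverse of \<open>P\<close>
  keeps its zero rows and turns it into a conjugate of \<open>B\<close>. Up to the same change of basis, \<open>G\<close>
  selects the pivot columns.\<close>

lemma similar_to_independent_rows:
  fixes B :: "'a::field mat"
  assumes B: "B \<in> carrier_mat n n"
  obtains B' G r where "similar_mat B B'" "B' \<in> carrier_mat n n" "G \<in> carrier_mat n n" "r \<le> n"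
    "\<And>i j. r \<le> i \<Longrightarrow> i < n \<Longrightarrow> j < n \<Longrightarrow> B' $$ (i, j) = 0"
    "B' * G = truncated_one n r"
proof -
  define C where "C = gauss_jordan_single B"
  note gj = gauss_jordan_single[OF B C_def[symmetric]]
  from gj(4) obtain P Q where CPB: "C = P * B" and P: "P \<in> carrier_mat n n" and Q: "Q \<in> carrier_mat n n"
    and PQ: "P * Q = 1\<^sub>m n" and QP: "Q * P = 1\<^sub>m n" by blast
  have C: "C \<in> carrier_mat n n" by (rule gj(2))
  from gj(3) C obtain f where f: "pivot_fun C f n" unfolding row_echelon_form_def by auto
  have dC: "dim_row C = n" using C by simp
  note pf = pivot_funD[OF dC f]
  \<comment> \<open>The pivot function takes the value \<open>n\<close> exactly on the zero rows, which come last.\<close>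
  define r where "r = (LEAST i. n \<le> i \<or> f i = n)"
  have r: "n \<le> r \<or> f r = n" unfolding r_def by (rule LeastI[of _ n]) simp
  have rn: "r \<le> n" unfolding r_def by (rule Least_le) simp
  have small: "f i < n" if "i < r" for i
    using not_less_Least[OF that[unfolded r_def]] pf(1)[of i] that rn by auto
  have large: "f i = n" if "r \<le> i" "i < n" for i
    using that
  proof (induction i rule: dec_induct)
    case base
    with r show ?case by auto
  next
    case (step i)
    then have "f i = n" by simp
    with pf(3)[of i] pf(1)[of "Suc i"] step.prems show ?case by auto
  qed
  define G0 where "G0 = mat n n (\<lambda>(j, i). if i < r \<and> j = f i then (1::'a) else 0)"
  have G0: "G0 \<in> carrier_mat n n" by (simp add: G0_def)
  have CG0: "C * G0 = truncated_one n r"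
  proof (rule eq_matI)
    fix i j assume "i < dim_row (truncated_one n r :: 'a mat)" "j < dim_col (truncated_one n r :: 'a mat)"
    then have ij: "i < n" "j < n" by auto
    have "(C * G0) $$ (i, j) = (\<Sum>l = 0..<n. (if l = f j then (if j < r then C $$ (i, f j) else 0) else 0))"
      using ij C by (auto simp: G0_def scalar_prod_def simp del: sum.delta sum.delta' intro!: sum.cong)
    also have "\<dots> = (if j < r then C $$ (i, f j) else 0)"
      using small by auto
    also have "\<dots> = truncated_one n r $$ (i, j)"
      using ij pf(4)[of j] pf(5)[of j i] small[of j] by (auto simp: truncated_one_def)
    finally show "(C * G0) $$ (i, j) = truncated_one n r $$ (i, j)" .
  qed (use C in \<open>auto simp: G0_def\<close>)
  show thesis
  proof (rule that)
    show "similar_mat B (C * Q)"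
      unfolding CPB by (rule similar_mat_sym, rule similar_matI[of _ _ P Q n]) (use B P Q PQ QP in auto)
    show "C * Q \<in> carrier_mat n n" "P * G0 \<in> carrier_mat n n" "r \<le> n" using C Q P G0 rn by auto
    show "(C * Q) $$ (i, j) = 0" if "r \<le> i" "i < n" "j < n" for i j
      using that C Q pf(2)[of i] large[of i] by (auto simp: scalar_prod_def)
    have "C * Q * (P * G0) = C * ((Q * P) * G0)"
      using C Q P G0 by (simp add: assoc_mult_mat[of _ n n _ n _ n])
    then show "C * Q * (P * G0) = truncated_one n r"
      using QP G0 CG0 by simp
  qed
qed

section \<open>The block triangular remainder\<close>

text \<open>Reversing the order of the basis exchanges the two kinds of triangular matrices.\<close>

lemma strictly_lower_similar_strictly_upper:
  fixes Y :: "'a::comm_ring_1 mat"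
  assumes Y: "Y \<in> carrier_mat n n" and low: "\<And>i j. i \<le> j \<Longrightarrow> j < n \<Longrightarrow> Y $$ (i, j) = 0"
  obtains Y' where "Y' \<in> carrier_mat n n" "similar_mat Y Y'"
    "\<And>i j. j \<le> i \<Longrightarrow> i < n \<Longrightarrow> Y' $$ (i, j) = 0"
proof -
  define J where "J = mat n n (\<lambda>(i, j). if j = n - Suc i then (1::'a) else 0)"
  have J: "J \<in> carrier_mat n n" by (simp add: J_def)
  have JZ: "(J * Z) $$ (i, j) = Z $$ (n - Suc i, j)"
    if "Z \<in> carrier_mat n n" "i < n" "j < n" for Z i j
  proof -
    have "(J * Z) $$ (i, j) = (\<Sum>l = 0..<n. (if l = n - Suc i then Z $$ (n - Suc i, j) else 0))"
      using that by (auto simp: J_def scalar_prod_def simp del: sum.delta sum.delta' intro!: sum.cong)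
    then show ?thesis using that by simp
  qed
  have ZJ: "(Z * J) $$ (i, j) = Z $$ (i, n - Suc j)"
    if "Z \<in> carrier_mat n n" "i < n" "j < n" for Z i j
  proof -
    have "(Z * J) $$ (i, j) = (\<Sum>l = 0..<n. (if l = n - Suc j then Z $$ (i, n - Suc j) else 0))"
      using that by (auto simp: J_def scalar_prod_def simp del: sum.delta sum.delta' intro!: sum.cong)
    then show ?thesis using that by simp
  qed
  have JJ: "J * J = 1\<^sub>m n"
    by (intro eq_matI) (use J JZ[OF J] in \<open>auto simp: J_def\<close>)
  show thesis
  proof (rule that)
    show "J * Y * J \<in> carrier_mat n n" using J Y by simp
    show "similar_mat Y (J * Y * J)"
      by (rule similar_mat_sym, rule similar_matI[of _ _ J J n]) (use J Y JJ in auto)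
    show "(J * Y * J) $$ (i, j) = 0" if "j \<le> i" "i < n" for i j
    proof -
      have "(J * Y * J) $$ (i, j) = Y $$ (n - Suc i, n - Suc j)"
        using ZJ[of "J * Y" i j] JZ[of Y i "n - Suc j"] J Y that by simp
      also have "\<dots> = 0" using that by (intro low) auto
      finally show ?thesis .
    qed
  qed
qed

text \<open>Only the first diagonal block is lower triangular. Reversing its part of the basis makes the
  whole matrix upper triangular, and the diagonal of \<open>X\<close> contributes the only possible nonzero
  eigenvalue.\<close>

lemma triangular_blocks_difference:
  fixes X Y :: "'a::field mat"
  assumes n: "0 < n" and X: "X \<in> carrier_mat n n" and Y: "Y \<in> carrier_mat n n"
    and low: "\<And>i j. i \<le> j \<Longrightarrow> j < n \<Longrightarrow> Y $$ (i, j) = 0"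
    and up: "\<And>i j. j < i \<Longrightarrow> i < n \<Longrightarrow> X $$ (i, j) = 0"
    and diag: "\<And>i. i < n \<Longrightarrow> i \<noteq> p \<Longrightarrow> X $$ (i, i) = 0" and p: "p < n"
  shows "\<exists>b. scaled_idempotent_difference (n + n) b (four_block_mat Y X (0\<^sub>m n n) X)"
proof -
  obtain Y' where Y': "Y' \<in> carrier_mat n n" and sim: "similar_mat Y Y'"
    and up': "\<And>i j. j \<le> i \<Longrightarrow> i < n \<Longrightarrow> Y' $$ (i, j) = 0"
    using strictly_lower_similar_strictly_upper[OF Y low] by blast
  obtain Z where Z: "Z \<in> carrier_mat n n"
    and simN: "similar_mat (four_block_mat Y X (0\<^sub>m n n) X) (four_block_mat Y' Z (0\<^sub>m n n) X)"
    using similar_mat_four_block_0_ex[OF sim similar_mat_refl[OF X] X Y X] by blast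
  let ?N = "four_block_mat Y' Z (0\<^sub>m n n) X"
  have "\<exists>b. scaled_idempotent_difference (n + n) b ?N"
  proof (rule upper_triangular_one_eigenvalue_difference)
    show "?N \<in> carrier_mat (n + n) (n + n)" using Y' X by simp
    show "upper_triangular ?N"
      by (rule upper_triangular_four_block[OF Y' X]) (use up up' X Y' in auto)
    show "n + p < n + n" using p by simp
    show "?N $$ (i, i) = 0" if "i < n + n" "i \<noteq> n + p" for i
      using that up' diag[of "i - n"] X Y' by auto
  qed
  with scaled_idempotent_difference_similar[OF simN] show ?thesis by blast
qed

section \<open>Splitting off the first idempotent\<close>

text \<open>With \<open>D = Y - a F\<close> one has \<open>X + D = B\<close>, and the identity
  \<open>[[D, X], [D, X]] + a I = a P + [[Y, X], [0, X]]\<close> holds for \<open>P = [[I - F, 0], [D / a, I]]\<close>, which is idempotent because \<open>D F = D\<close>. So it suffices to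
  see that \<open>[[D, X], [D, X]]\<close> is similar to \<open>[[B, 0], [0, 0]]\<close>. Conjugation by
  \<open>[[I, K], [I, I + K]]\<close> does this as soon as \<open>B K = - X\<close>, and the hypotheses on \<open>G\<close> and \<open>F\<close> make
  \<open>K = G D - I\<close> such a matrix: \<open>B G D = F D = D\<close>.\<close>

lemma composite_from_splitting:
  fixes B G F X Y :: "'a::field mat"
  assumes a: "a \<noteq> 0"
    and c: "B \<in> carrier_mat n n" "G \<in> carrier_mat n n" "F \<in> carrier_mat n n"
      "X \<in> carrier_mat n n" "Y \<in> carrier_mat n n"
    and FF: "F * F = F" and BG: "B * G = F" and FY: "F * Y = Y" and YF: "Y * F = Y"
    and XY: "X + Y = B + a \<cdot>\<^sub>m F"
    and N: "scaled_idempotent_difference (n + n) b (four_block_mat Y X (0\<^sub>m n n) X)"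
  shows "composite (n + n) [a, b, - b]
    (four_block_mat (B + a \<cdot>\<^sub>m 1\<^sub>m n) (0\<^sub>m n n) (0\<^sub>m n n) (a \<cdot>\<^sub>m 1\<^sub>m n))"
proof -
  let ?I = "1\<^sub>m n :: 'a mat" and ?O = "0\<^sub>m n n :: 'a mat"
  define D where "D = Y - a \<cdot>\<^sub>m F"
  define K where "K = G * D - ?I"
  have cD: "D \<in> carrier_mat n n" and cK: "K \<in> carrier_mat n n"
    using c by (auto simp: D_def K_def)
  have DF: "D * F = D"
    unfolding D_def using c YF FF
    by (simp add: minus_mult_distrib_mat[of _ n n _ _ n] mult_smult_assoc_mat[of _ n n _ n])
  have FD: "F * D = D"
    unfolding D_def using c FY FF
    by (simp add: mult_minus_distrib_mat[of _ n n _ n] mult_smult_distrib[of _ n n _ n])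
  have XD: "X + D = B"
  proof (rule eq_matI)
    fix i j assume "i < dim_row B" "j < dim_col B"
    then have ij: "i < n" "j < n" using c by auto
    then have "(X + Y) $$ (i, j) = (B + a \<cdot>\<^sub>m F) $$ (i, j)" using XY by simp
    then show "(X + D) $$ (i, j) = B $$ (i, j)"
      using ij c by (simp add: D_def algebra_simps)
  qed (use c cD in auto)
  have "B * K = B * (G * D) - B"
    unfolding K_def using c cD by (simp add: mult_minus_distrib_mat[of _ n n _ n])
  also have "B * (G * D) = D"
    using c cD BG FD by (simp flip: assoc_mult_mat[of _ n n _ n _ n])
  also have "D - B = - X"
    unfolding XD[symmetric] using c cD by (intro eq_matI) auto
  finally have BK: "B * K = - X" .
  define g where "g = four_block_mat ?I K ?I (?I + K)"
  define h where "h = four_block_mat (?I + K) (- K) (- ?I) ?I"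
  let ?M = "four_block_mat (B + a \<cdot>\<^sub>m ?I) ?O ?O (a \<cdot>\<^sub>m ?I)"
  let ?W = "four_block_mat (D + a \<cdot>\<^sub>m ?I) X D (X + a \<cdot>\<^sub>m ?I)"
  have cg: "g \<in> carrier_mat (n + n) (n + n)" "h \<in> carrier_mat (n + n) (n + n)"
    "?M \<in> carrier_mat (n + n) (n + n)" "?W \<in> carrier_mat (n + n) (n + n)"
    using c cD cK by (auto simp: g_def h_def)
  note dist = add_mult_distrib_mat[of _ n n _ _ n] mult_add_distrib_mat[of _ n n _ n]
    mult_smult_assoc_mat[of _ n n _ n] mult_smult_distrib[of _ n n _ n]
  have cKK: "K * K \<in> carrier_mat n n" using cK by simp
  have hg: "h * g = 1\<^sub>m (n + n)"
  proof -
    have "h * g = four_block_mat ?I ?O ?O ?I"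
      unfolding g_def h_def using cK
      by (subst mult_four_block_mat[of _ n n _ n _ n _ _ n _ n], simp_all add: dist)
        (intro cong_four_block_mat eq_matI, use cK cKK in \<open>auto simp del: index_mult_mat(1)\<close>)
    then show ?thesis by simp
  qed
  have gh: "g * h = 1\<^sub>m (n + n)"
  proof -
    have "g * h = four_block_mat ?I ?O ?O ?I"
      unfolding g_def h_def using cK
      by (subst mult_four_block_mat[of _ n n _ n _ n _ _ n _ n], simp_all add: dist)
        (intro cong_four_block_mat eq_matI, use cK cKK in \<open>auto simp del: index_mult_mat(1)\<close>)
    then show ?thesis by simp
  qed
  have DK: "D * K + X * K = - X"
  proof -
    have "D * K + X * K = (X + D) * K"
      using c cD cK by (simp add: dist comm_add_mat[of _ n n])
    then show ?thesis using XD BK by simp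
  qed
  have DKij: "(X * K) $$ (i, j) = - X $$ (i, j) - (D * K) $$ (i, j)" if "i < n" "j < n" for i j
  proof -
    have "(D * K + X * K) $$ (i, j) = (- X) $$ (i, j)" using DK by simp
    then show ?thesis using that c cD cK by (simp add: algebra_simps del: index_mult_mat(1))
  qed
  have cP: "D * K \<in> carrier_mat n n" "X * K \<in> carrier_mat n n" using c cD cK by auto
  have Wg: "?W * g = four_block_mat (B + a \<cdot>\<^sub>m ?I) (a \<cdot>\<^sub>m K) (B + a \<cdot>\<^sub>m ?I) (a \<cdot>\<^sub>m ?I + a \<cdot>\<^sub>m K)"
    unfolding g_def XD[symmetric] using c cD cK
    by (subst mult_four_block_mat[of _ n n _ n _ n _ _ n _ n], simp_all add: dist)
      (intro cong_four_block_mat eq_matI,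
        use cP in \<open>auto simp: DKij algebra_simps simp del: index_mult_mat(1)\<close>)
  have gM: "g * ?M = four_block_mat (B + a \<cdot>\<^sub>m ?I) (a \<cdot>\<^sub>m K) (B + a \<cdot>\<^sub>m ?I) (a \<cdot>\<^sub>m ?I + a \<cdot>\<^sub>m K)"
    unfolding g_def using c cD cK
    by (subst mult_four_block_mat[of _ n n _ n _ n _ _ n _ n])
      (simp_all add: dist add_smult_distrib_left_mat[of _ n n])
  have sim: "similar_mat ?M ?W"
  proof (rule similar_matI[of _ _ h g "n + n"])
    have "?M = h * (g * ?M)"
      using cg hg by (simp flip: assoc_mult_mat[of _ "n + n" "n + n" _ "n + n" _ "n + n"])
    also have "\<dots> = h * ?W * g"
      unfolding gM Wg[symmetric] using cg by (simp add: assoc_mult_mat[of _ "n + n" "n + n" _ "n + n" _ "n + n"])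
    finally show "?M = h * ?W * g" .
  qed (use cg gh hg in auto)
  define P where "P = four_block_mat (?I - F) ?O (inverse a \<cdot>\<^sub>m D) ?I"
  have carrP: "P \<in> carrier_mat (n + n) (n + n)"
    unfolding P_def using c cD by (auto intro!: four_block_carrier_mat)
  have cIF: "?I - F \<in> carrier_mat n n" using c by (intro minus_carrier_mat)
  have IF: "(?I - F) * (?I - F) = ?I - F"
  proof -
    have "(?I - F) * (?I - F) = (?I - F) * ?I - (?I - F) * F"
      by (rule mult_minus_distrib_mat[OF cIF one_carrier_mat c(3)])
    also have "(?I - F) * ?I = ?I - F" by (rule right_mult_one_mat[OF cIF])
    also have "(?I - F) * F = ?I * F - F * F"
      by (rule minus_mult_distrib_mat[OF one_carrier_mat c(3) c(3)])
    also have "?I * F = F" by (rule left_mult_one_mat[OF c(3)])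
    also have "(?I - F) - (F - F * F) = ?I - F" unfolding FF using c by (intro eq_matI) auto
    finally show ?thesis .
  qed
  have DIF: "D * (?I - F) = ?O"
    using c cD DF by (simp add: mult_minus_distrib_mat[of _ n n _ n])
  have PP: "P * P = P"
    unfolding P_def using c cD cIF IF DIF
    by (subst mult_four_block_mat[of _ n n _ n _ n _ _ n _ n])
      (simp_all add: mult_smult_assoc_mat[of _ n n _ n])
  from N obtain Q R where Q: "Q \<in> carrier_mat (n + n) (n + n)" "Q * Q = Q"
    and R: "R \<in> carrier_mat (n + n) (n + n)" "R * R = R"
    and NQR: "four_block_mat Y X ?O X = b \<cdot>\<^sub>m Q + (- b) \<cdot>\<^sub>m R"
    unfolding scaled_idempotent_difference_def by blast
  have "a \<cdot>\<^sub>m P + four_block_mat Y X ?O X = four_block_mat (a \<cdot>\<^sub>m (?I - F) + Y)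
      (a \<cdot>\<^sub>m ?O + X) (a \<cdot>\<^sub>m (inverse a \<cdot>\<^sub>m D) + ?O) (a \<cdot>\<^sub>m ?I + X)"
    unfolding P_def using c cD cIF
    by (simp add: smult_four_block_mat[of _ n n _ n _ n] add_four_block_mat[of _ n n _ n _ n])
  also have "a \<cdot>\<^sub>m (?I - F) + Y = D + a \<cdot>\<^sub>m ?I"
    using c cD by (intro eq_matI) (auto simp: D_def right_diff_distrib)
  also have "a \<cdot>\<^sub>m ?O + X = X" using c by (intro eq_matI) auto
  also have "a \<cdot>\<^sub>m (inverse a \<cdot>\<^sub>m D) + ?O = D" using cD a by (intro eq_matI) auto
  also have "a \<cdot>\<^sub>m ?I + X = X + a \<cdot>\<^sub>m ?I" using c by (intro comm_add_mat[of _ n n]) auto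
  finally have W: "?W = a \<cdot>\<^sub>m P + (b \<cdot>\<^sub>m Q + (- b) \<cdot>\<^sub>m R)" by (simp only: NQR)
  have "composite (n + n) [a, b, - b] ?W"
    unfolding composite_three_iff
    by (intro exI[of _ P] exI[of _ Q] exI[of _ R] conjI carrP Q(1) R(1) PP Q(2) R(2) W)
  with composite_similar[OF sim] show ?thesis .
qed

text \<open>Here \<open>B\<^sup>2 = B F B = s B\<close>. For \<open>s \<noteq> 0\<close> the matrix \<open>B\<close> is a multiple of an idempotent. For
  \<open>s = 0\<close> it is the difference of the idempotents \<open>F + B\<close> and \<open>F\<close>. In both cases the identity
  matrix serves as the first idempotent of the composite.\<close>

lemma composite_shift_block_quadratic:
  fixes B F :: "'a::field mat"
  assumes c: "B \<in> carrier_mat n n" "F \<in> carrier_mat n n"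
    and FF: "F * F = F" and FB: "F * B = B" and BF: "B * F = s \<cdot>\<^sub>m F"
  shows "\<exists>b c. composite (n + n) [a, b, c]
    (four_block_mat (B + a \<cdot>\<^sub>m 1\<^sub>m n) (0\<^sub>m n n) (0\<^sub>m n n) (a \<cdot>\<^sub>m 1\<^sub>m n))"
proof -
  let ?E = "\<lambda>X. four_block_mat X (0\<^sub>m n n) (0\<^sub>m n n) (0\<^sub>m n n) :: 'a mat"
  let ?M = "four_block_mat (B + a \<cdot>\<^sub>m 1\<^sub>m n) (0\<^sub>m n n) (0\<^sub>m n n) (a \<cdot>\<^sub>m 1\<^sub>m n)"
  have E: "?E X * ?E X = ?E X" if "X \<in> carrier_mat n n" "X * X = X" for X
    using that by (subst mult_four_block_mat[of _ n n _ n _ n _ _ n _ n]) auto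
  have split: "composite (n + n) [a, b, c] ?M"
    if "Q \<in> carrier_mat n n" "R \<in> carrier_mat n n" "Q * Q = Q" "R * R = R"
      "B = b \<cdot>\<^sub>m Q + c \<cdot>\<^sub>m R" for b c Q R
    unfolding composite_three_iff
  proof (intro exI conjI)
    show "?M = a \<cdot>\<^sub>m 1\<^sub>m (n + n) + (b \<cdot>\<^sub>m ?E Q + c \<cdot>\<^sub>m ?E R)"
      unfolding that(5) using that(1,2) by (intro eq_matI) auto
  qed (use that E in auto)
  have BB: "B * B = s \<cdot>\<^sub>m B"
  proof -
    have "B * B = B * (F * B)" by (simp add: FB)
    also have "\<dots> = (B * F) * B" using c by (simp add: assoc_mult_mat[of _ n n _ n _ n])
    also have "\<dots> = s \<cdot>\<^sub>m B" unfolding BF using c FB by (simp add: mult_smult_assoc_mat[of _ n n _ n])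
    finally show ?thesis .
  qed
  show ?thesis
  proof (cases "s = 0")
    case True
    have BF0: "B * F = 0\<^sub>m n n" and BB0: "B * B = 0\<^sub>m n n"
      unfolding BF BB True using c by (auto intro!: eq_matI)
    have "(F + B) * (F + B) = F + B"
      using c by (simp add: add_mult_distrib_mat[of _ n n _ _ n] mult_add_distrib_mat[of _ n n _ n]
          FF FB BF0 BB0)
    moreover have "F + B \<in> carrier_mat n n" using c by simp
    moreover have "B = 1 \<cdot>\<^sub>m (F + B) + (- 1) \<cdot>\<^sub>m F"
      using c by (intro eq_matI) auto
    ultimately show ?thesis using split[of "F + B" F 1 "- 1"] c FF by blast
  next
    case False
    have "(inverse s \<cdot>\<^sub>m B) * (inverse s \<cdot>\<^sub>m B) = inverse s \<cdot>\<^sub>m B"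
      using c False by (simp add: mult_smult_assoc_mat[of _ n n _ n] mult_smult_distrib[of _ n n _ n] BB)
        (intro eq_matI, auto)
    moreover have "B = s \<cdot>\<^sub>m (inverse s \<cdot>\<^sub>m B) + 0 \<cdot>\<^sub>m 0\<^sub>m n n"
      using c False by (intro eq_matI) auto
    ultimately show ?thesis using split[of "inverse s \<cdot>\<^sub>m B" "0\<^sub>m n n" s 0] c by auto
  qed
qed

section \<open>Decomposition of every matrix\<close>

text \<open>The splitting of \<open>B + a F\<close> is into its strictly lower part \<open>Y\<close> and its upper part \<open>X\<close>. The
  diagonal hypothesis leaves \<open>X\<close> with at most one nonzero diagonal entry; the vanishing rows of \<open>B\<close>
  confine \<open>Y\<close> to the leading \<open>r\<close> by \<open>r\<close> block, where \<open>F\<close> acts as the identity from both sides.\<close>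

lemma composite_shift_block_zero_diagonal:
  fixes B G :: "'a::field mat"
  assumes a: "a \<noteq> 0" and n: "0 < n"
    and B: "B \<in> carrier_mat n n" and G: "G \<in> carrier_mat n n" and r: "r \<le> n"
    and rows: "\<And>i j. r \<le> i \<Longrightarrow> i < n \<Longrightarrow> j < n \<Longrightarrow> B $$ (i, j) = 0"
    and BG: "B * G = truncated_one n r"
    and diag: "\<And>i. Suc i < r \<Longrightarrow> B $$ (i, i) + a = 0"
  shows "\<exists>b c. composite (n + n) [a, b, c]
    (four_block_mat (B + a \<cdot>\<^sub>m 1\<^sub>m n) (0\<^sub>m n n) (0\<^sub>m n n) (a \<cdot>\<^sub>m 1\<^sub>m n))"
proof -
  let ?F = "truncated_one n r :: 'a mat"
  define S where "S = B + a \<cdot>\<^sub>m ?F"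
  have S: "S \<in> carrier_mat n n" using B by (simp add: S_def)
  have Sij: "S $$ (i, j) = B $$ (i, j) + (if i = j \<and> i < r then a else 0)" if "i < n" "j < n" for i j
    using that B by (simp add: S_def truncated_one_def)
  define Y where "Y = mat n n (\<lambda>(i, j). if j < i then S $$ (i, j) else 0)"
  define X where "X = mat n n (\<lambda>(i, j). if j < i then 0 else S $$ (i, j))"
  have c: "X \<in> carrier_mat n n" "Y \<in> carrier_mat n n" by (simp_all add: X_def Y_def)
  have FF: "?F * ?F = ?F"
    unfolding truncated_one_mult_left[OF truncated_one_carrier(1)]
    by (intro eq_matI) (auto simp: truncated_one_def)
  have FY: "?F * Y = Y"
    unfolding truncated_one_mult_left[OF c(2)]
    by (intro eq_matI) (use rows in \<open>auto simp: Y_def Sij\<close>)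
  have YF: "Y * ?F = Y"
    unfolding truncated_one_mult_right[OF c(2)]
    by (intro eq_matI) (use rows in \<open>auto simp: Y_def Sij\<close>)
  have XY: "X + Y = B + a \<cdot>\<^sub>m ?F"
    unfolding S_def[symmetric] using S by (intro eq_matI) (auto simp: X_def Y_def)
  have "\<exists>b. scaled_idempotent_difference (n + n) b (four_block_mat Y X (0\<^sub>m n n) X)"
  proof (rule triangular_blocks_difference[OF n c])
    \<comment> \<open>For \<open>r = 0\<close> the truncated subtraction selects index 0, which is harmless: then \<open>X = 0\<close>.\<close>
    show "r - 1 < n" using r n by auto
    show "X $$ (i, i) = 0" if "i < n" "i \<noteq> r - 1" for i
      using that rows[of i i] diag[of i] by (auto simp: X_def Sij)
  qed (auto simp: X_def Y_def)
  then obtain b where N: "scaled_idempotent_difference (n + n) b (four_block_mat Y X (0\<^sub>m n n) X)" ..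
  from composite_from_splitting[OF a B G truncated_one_carrier(1) c FF BG FY YF XY N]
  show ?thesis by blast
qed

lemma similar_shift:
  fixes A :: "'a::comm_ring_1 mat"
  assumes sim: "similar_mat A A'" and A': "A' \<in> carrier_mat n n"
  shows "similar_mat (A + a \<cdot>\<^sub>m 1\<^sub>m n) (A' + a \<cdot>\<^sub>m 1\<^sub>m n)"
proof -
  from similar_matD[OF sim] A' obtain P Q where c: "A \<in> carrier_mat n n" "P \<in> carrier_mat n n" "Q \<in> carrier_mat n n"
    and PQ: "P * Q = 1\<^sub>m n" "Q * P = 1\<^sub>m n" and A: "A = P * A' * Q"
    by (metis carrier_matD(1) insert_subset)
  have "P * (A' + a \<cdot>\<^sub>m 1\<^sub>m n) * Q = P * A' * Q + a \<cdot>\<^sub>m (P * Q)"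
    using c A' by (simp add: add_mult_distrib_mat[of _ n n _ _ n] mult_add_distrib_mat[of _ n n _ n]
        mult_smult_assoc_mat[of _ n n _ n] mult_smult_distrib[of _ n n _ n])
  then have "A + a \<cdot>\<^sub>m 1\<^sub>m n = P * (A' + a \<cdot>\<^sub>m 1\<^sub>m n) * Q" by (simp add: A PQ)
  then show ?thesis
    by (intro similar_matI[of _ _ P Q n]) (use c A' PQ in auto)
qed

lemma composite_shift_block_similar:
  fixes B :: "'a::field mat"
  assumes sim: "similar_mat B B'" and B': "B' \<in> carrier_mat n n"
    and comp: "composite (n + n) [a, b, c]
      (four_block_mat (B' + a \<cdot>\<^sub>m 1\<^sub>m n) (0\<^sub>m n n) (0\<^sub>m n n) (a \<cdot>\<^sub>m 1\<^sub>m n))"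
  shows "composite (n + n) [a, b, c]
      (four_block_mat (B + a \<cdot>\<^sub>m 1\<^sub>m n) (0\<^sub>m n n) (0\<^sub>m n n) (a \<cdot>\<^sub>m 1\<^sub>m n))"
proof (rule composite_similar[OF similar_mat_four_block_0_0 comp])
  show "similar_mat (B + a \<cdot>\<^sub>m 1\<^sub>m n) (B' + a \<cdot>\<^sub>m 1\<^sub>m n)" by (rule similar_shift[OF sim B'])
  show "similar_mat (a \<cdot>\<^sub>m 1\<^sub>m n) (a \<cdot>\<^sub>m 1\<^sub>m n)" by (rule similar_mat_refl[of _ n]) simp
  have "B \<in> carrier_mat n n"
    using similar_matD[OF sim] B' by (metis carrier_matD(1) insert_subset)
  then show "B + a \<cdot>\<^sub>m 1\<^sub>m n \<in> carrier_mat n n" by simp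
qed simp

text \<open>Only the leading block \<open>C1 + a I\<close> matters for the choice between the two constructions. If it is
  scalar, the quadratic case applies. Otherwise its diagonal, up to the last entry, is cleared by a
  change of basis that extends by the identity to the remaining coordinates, and thus preserves both the zero rows and
  the truncated identity.\<close>

lemma composite_shift_block:
  fixes B :: "'a::field mat"
  assumes a: "a \<noteq> 0" and n: "0 < n" and B: "B \<in> carrier_mat n n"
  shows "\<exists>b c. composite (n + n) [a, b, c]
    (four_block_mat (B + a \<cdot>\<^sub>m 1\<^sub>m n) (0\<^sub>m n n) (0\<^sub>m n n) (a \<cdot>\<^sub>m 1\<^sub>m n))"
proof -
  obtain C G r where simC: "similar_mat B C" and C: "C \<in> carrier_mat n n" and G: "G \<in> carrier_mat n n"
    and r: "r \<le> n" and rows: "\<And>i j. r \<le> i \<Longrightarrow> i < n \<Longrightarrow> j < n \<Longrightarrow> C $$ (i, j) = 0"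
    and CG: "C * G = truncated_one n r"
    using similar_to_independent_rows[OF B] by metis
  let ?F = "truncated_one n r :: 'a mat"
  define q where "q = n - r"
  have nrq: "n = r + q" using r by (simp add: q_def)
  define C1 where "C1 = mat r r (\<lambda>(i, j). C $$ (i, j))"
  define C2 where "C2 = mat r q (\<lambda>(i, j). C $$ (i, r + j))"
  have c12: "C1 \<in> carrier_mat r r" "C2 \<in> carrier_mat r q" by (simp_all add: C1_def C2_def)
  have Cblock: "C = four_block_mat C1 C2 (0\<^sub>m q r) (0\<^sub>m q q)"
    using C rows nrq by (intro eq_matI) (auto simp: C1_def C2_def)
  define T where "T = C1 + a \<cdot>\<^sub>m 1\<^sub>m r"
  have T: "T \<in> carrier_mat r r" using c12 by (simp add: T_def)
  from scalar_or_similar_zero_diagonal[OF T]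
  have "\<exists>b c. composite (n + n) [a, b, c]
    (four_block_mat (C + a \<cdot>\<^sub>m 1\<^sub>m n) (0\<^sub>m n n) (0\<^sub>m n n) (a \<cdot>\<^sub>m 1\<^sub>m n))"
  proof
    assume "\<exists>c. T = c \<cdot>\<^sub>m 1\<^sub>m r"
    then obtain t where t: "T = t \<cdot>\<^sub>m 1\<^sub>m r" ..
    have corner: "C $$ (i, j) = (if i = j then t - a else 0)" if "i < r" "j < r" for i j
    proof -
      have "T $$ (i, j) = (t \<cdot>\<^sub>m 1\<^sub>m r) $$ (i, j)" by (simp only: t)
      then show ?thesis using that by (auto simp: T_def C1_def algebra_simps split: if_splits)
    qed
    show ?thesis
    proof (rule composite_shift_block_quadratic[OF C truncated_one_carrier(1)])
      show "?F * ?F = ?F"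
        unfolding truncated_one_mult_left[OF truncated_one_carrier(1)]
        by (intro eq_matI) (auto simp: truncated_one_def)
      show "?F * C = C"
        unfolding truncated_one_mult_left[OF C]
        by (intro eq_matI) (use rows C in auto)
      show "C * ?F = (t - a) \<cdot>\<^sub>m ?F"
        unfolding truncated_one_mult_right[OF C]
      proof (intro eq_matI)
        fix i j assume "i < dim_row ((t - a) \<cdot>\<^sub>m ?F)" "j < dim_col ((t - a) \<cdot>\<^sub>m ?F)"
        then show "mat n n (\<lambda>(i, j). if j < r then C $$ (i, j) else 0) $$ (i, j) = ((t - a) \<cdot>\<^sub>m ?F) $$ (i, j)"
          using corner[of i j] rows[of i j] by (cases "i < r") (auto simp: truncated_one_def)
      qed auto
    qed
  next
    assume "\<exists>S'. similar_mat T S' \<and> (\<forall>i. Suc i < r \<longrightarrow> S' $$ (i, i) = 0)"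
    then obtain S' where simT: "similar_mat T S'" and diag: "\<And>i. Suc i < r \<Longrightarrow> S' $$ (i, i) = 0"
      by blast
    have S': "S' \<in> carrier_mat r r"
      using similar_matD[OF simT] T by (metis carrier_matD(1) insert_subset)
    have "similar_mat (T + (- a) \<cdot>\<^sub>m 1\<^sub>m r) (S' + (- a) \<cdot>\<^sub>m 1\<^sub>m r)"
      by (rule similar_shift[OF simT S'])
    moreover have "T + (- a) \<cdot>\<^sub>m 1\<^sub>m r = C1"
      unfolding T_def using c12 by (intro eq_matI) auto
    ultimately obtain P Q where wit: "similar_mat_wit C1 (S' + (- a) \<cdot>\<^sub>m 1\<^sub>m r) P Q"
      unfolding similar_mat_def by auto
    note PQ = similar_mat_witD2[OF c12(1) wit]
    define C' where "C' = four_block_mat (S' + (- a) \<cdot>\<^sub>m 1\<^sub>m r) (Q * C2) (0\<^sub>m q r) (0\<^sub>m q q)"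
    have C': "C' \<in> carrier_mat n n" unfolding C'_def nrq using S' by simp
    define U where "U = four_block_mat P (0\<^sub>m r q) (0\<^sub>m q r) (1\<^sub>m q)"
    define V where "V = four_block_mat Q (0\<^sub>m r q) (0\<^sub>m q r) (1\<^sub>m q)"
    have wit': "similar_mat_wit C C' U V"
      unfolding Cblock C'_def U_def V_def
    proof (rule similar_mat_wit_four_block[OF wit similar_mat_wit_refl])
      show "C2 = P * (Q * C2) * 1\<^sub>m q"
        using c12 PQ by (simp flip: assoc_mult_mat[of _ r r _ r _ q])
      show "0\<^sub>m q r = 1\<^sub>m q * 0\<^sub>m q r * Q" using PQ by simp
    qed (use c12 PQ in auto)
    note UV = similar_mat_witD2[OF C wit']
    have Fblock: "?F = four_block_mat (1\<^sub>m r) (0\<^sub>m r q) (0\<^sub>m q r) (0\<^sub>m q q)"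
      using nrq by (intro eq_matI) (auto simp: truncated_one_def)
    have VFU: "V * ?F * U = ?F"
      unfolding Fblock U_def V_def using PQ
      by (simp add: mult_four_block_mat[of _ r r _ q _ q _ _ r _ q])
    have C'VCU: "C' = V * C * U"
      using similar_mat_witD2(3)[OF C' similar_mat_wit_sym[OF wit']] .
    have "C' * (V * G * U) = V * (C * ((U * V) * (G * U)))"
      unfolding C'VCU using C G UV(6,7) by (simp add: assoc_mult_mat[of _ n n _ n _ n])
    also have "\<dots> = V * (C * G) * U"
      using C G UV(1,6,7) by (simp add: assoc_mult_mat[of _ n n _ n _ n])
    also have "\<dots> = ?F" unfolding CG by (rule VFU)
    finally have C'G: "C' * (V * G * U) = ?F" .
    have "\<exists>b c. composite (n + n) [a, b, c]
      (four_block_mat (C' + a \<cdot>\<^sub>m 1\<^sub>m n) (0\<^sub>m n n) (0\<^sub>m n n) (a \<cdot>\<^sub>m 1\<^sub>m n))"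
    proof (rule composite_shift_block_zero_diagonal[OF a n C' _ r _ C'G])
      show "V * G * U \<in> carrier_mat n n" using G UV by simp
      show "C' $$ (i, j) = 0" if "r \<le> i" "i < n" "j < n" for i j
        using that S' nrq by (auto simp: C'_def)
      show "C' $$ (i, i) + a = 0" if "Suc i < r" for i
        using that S' nrq diag[OF that] by (auto simp: C'_def)
    qed
    moreover have "similar_mat C C'" using wit' unfolding similar_mat_def by blast
    ultimately show ?thesis using composite_shift_block_similar[OF _ C'] by blast
  qed
  then show ?thesis using composite_shift_block_similar[OF simC C] by blast
qed

theorem theorem6p1:
  fixes \<alpha> :: "'a::field" and n :: nat and A :: "'a mat"
  assumes "\<alpha> \<noteq> 0" and "n > 0" and "A \<in> carrier_mat n n"
  shows "\<exists>\<beta> \<gamma>. composite (2 * n) [\<alpha>, \<beta>, \<gamma>] (diag_block_mat [A, \<alpha> \<cdot>\<^sub>m 1\<^sub>m n])"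
proof -
  define B where "B = A - \<alpha> \<cdot>\<^sub>m 1\<^sub>m n"
  have B: "B \<in> carrier_mat n n"
    unfolding B_def by (intro minus_carrier_mat) simp
  have "A = B + \<alpha> \<cdot>\<^sub>m 1\<^sub>m n"
    using assms(3) unfolding B_def by (intro eq_matI) auto
  moreover have "diag_block_mat [A, \<alpha> \<cdot>\<^sub>m 1\<^sub>m n]
      = four_block_mat A (0\<^sub>m n n) (0\<^sub>m n n) (\<alpha> \<cdot>\<^sub>m 1\<^sub>m n)"
    using assms(3) by (intro eq_matI) (auto simp: Let_def)
  ultimately show ?thesis
    using composite_shift_block[OF assms(1,2) B] by (simp add: mult_2)
qed

end
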